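(* Let $a$ and $b$ be coprime positive integers. Let $m_0,m_1,m_2,\ldots,m_a$ be nonnegative integers such that $\sum_{i=0}^a i\,m_i=a$ and $\sum_{i=0}^a m_i=b$. Then the number of $(a,b)$-Dyck paths having exactly $m_i$ vertical runs of length $i$ for every $0\le i\le a$ is $$\frac{1}{b}\binom{b}{m_0,m_1,\ldots,m_a}=\frac{(b-1)!}{m_0!\,m_1!\cdots m_a!}.$$
   Context: A word in $\{N,E\}^{a+b}$ with $a$ letters $N$ and $b$ letters $E$ is viewed as a lattice path in $\mathbb{Z}^2$ from $(0,0)$ to $(b,a)$, reading left to right, where $N$ is a unit north step and $E$ is a unit east step. Such a word is an $(a,b)$-Dyck path if the path stays weakly above the line $y=\frac{a}{b}x$. (An $(a,b)$-Dyck path always ends in an east step.) A vertical run of length $i\ge 0$ in a path is an occurrence of a subword of consecutive letters $N^iE$ that either starts at the beginning of the whole word or is immediately preceded by a letter $E$. Thus a path ending in $E$ has exactly $b$ vertical runs, one for each east step (runs of length $0$ are counted). $\binom{b}{m_0,\ldots,m_a}=\frac{b!}{m_0!\cdots m_a!}$ is the multinomial coefficient. *)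

theory Defs
  imports Complex_Main
begin

datatype step = N | E

definition lattice_words :: "nat \<Rightarrow> nat \<Rightarrow> step list set" where
  "lattice_words a b = {w. count_list w N = a \<and> count_list w E = b}"

text \<open>The point of the integer lattice reached from the origin after the first \<open>k\<close> steps.\<close>

definition path_point :: "step list \<Rightarrow> nat \<Rightarrow> int \<times> int" where
  "path_point w k = (int (count_list (take k w) E), int (count_list (take k w) N))"

text \<open>It is enough to test the lattice points visited by the path: the closed half-plane above
  the line is convex, so it contains a unit step as soon as it contains both of its end points.\<close>

definition weakly_above :: "nat \<Rightarrow> nat \<Rightarrow> step list \<Rightarrow> bool" where
  "weakly_above a b w \<longleftrightarrow>
     (\<forall>k \<le> length w. case path_point w k of (x, y) \<Rightarrow>
        real_of_int y \<ge> (real a / real b) * real_of_int x)"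

definition dyck_paths :: "nat \<Rightarrow> nat \<Rightarrow> step list set" where
  "dyck_paths a b = {w \<in> lattice_words a b. weakly_above a b w}"

text \<open>A vertical run is identified with the index \<open>p\<close> at which its occurrence starts.\<close>

definition vertical_runs :: "nat \<Rightarrow> step list \<Rightarrow> nat set" where
  "vertical_runs i w =
     {p. take (Suc i) (drop p w) = replicate i N @ [E] \<and> (p = 0 \<or> w ! (p - 1) = E)}"

definition multinomial :: "nat \<Rightarrow> nat \<Rightarrow> (nat \<Rightarrow> nat) \<Rightarrow> real" where
  "multinomial b a m = fact b / (\<Prod>i=0..a. fact (m i))"

end

theory Submission
  imports Defs "HOL-Combinatorics.Multiset_Permutations"
begin

text \<open>A path ending in an east step is determined by the list of its \<open>b\<close> vertical run lengths, a
  list with sum \<open>a\<close>, and it is a Dyck path iff the partial sums satisfy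
  \<open>a * j \<le> b * (x\<^sub>1 + \<dots> + x\<^sub>j)\<close> for all \<open>j\<close>. The cycle lemma says that exactly one of the \<open>b\<close> cyclic
  rotations of such a list has this property: rotating by \<open>k\<close> works iff
  \<open>b * (x\<^sub>1 + \<dots> + x\<^sub>k) - a * k\<close> is minimal, and these values are pairwise distinct modulo \<open>b\<close>, since
  \<open>a\<close> and \<open>b\<close> are coprime. So a fraction \<open>1 / b\<close> of all arrangements of the prescribed multiset of
  run lengths gives Dyck paths.\<close>

section \<open>Encoding paths by their run lengths\<close>

definition path_of_runs :: "nat list \<Rightarrow> step list" where
  "path_of_runs xs = concat (map (\<lambda>i. replicate i N @ [E]) xs)"

lemma path_of_runs_Nil [simp]: "path_of_runs [] = []"
  by (simp add: path_of_runs_def)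

lemma path_of_runs_Cons [simp]:
  "path_of_runs (x # xs) = replicate x N @ E # path_of_runs xs"
  by (simp add: path_of_runs_def)

lemma path_of_runs_append [simp]:
  "path_of_runs (xs @ ys) = path_of_runs xs @ path_of_runs ys"
  by (simp add: path_of_runs_def)

lemma count_list_replicate_eq: "count_list (replicate n x) y = (if x = y then n else 0)"
  by (induction n) auto

lemma count_E_path_of_runs [simp]: "count_list (path_of_runs xs) E = length xs"
  by (induction xs) (auto simp: count_list_replicate_eq)

lemma count_N_path_of_runs [simp]: "count_list (path_of_runs xs) N = sum_list xs"
  by (induction xs) (auto simp: count_list_replicate_eq)

text \<open>Each \<open>E\<close> acts as a delimiter, so the first run length can be read off; this
  makes the encoding uniquely decodable.\<close>

lemma replicate_N_E_eq_iff:
  "replicate i N @ E # u = replicate j N @ E # v \<longleftrightarrow> i = j \<and> u = v"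
proof (induction i arbitrary: j)
  case 0
  show ?case by (cases j) auto
next
  case (Suc i)
  then show ?case by (cases j) auto
qed

lemma inj_path_of_runs: "inj path_of_runs"
proof (rule injI)
  fix xs ys assume "path_of_runs xs = path_of_runs ys"
  then show "xs = ys"
  proof (induction xs arbitrary: ys)
    case Nil
    then show ?case by (cases ys) auto
  next
    case (Cons x xs)
    then show ?case by (cases ys) (auto simp: replicate_N_E_eq_iff)
  qed
qed

text \<open>Reading a word from the left, an \<open>N\<close> lengthens the unfinished tail and an
  \<open>E\<close> closes it as a new run. The tail is kept because an arbitrary word need not end
  in \<open>E\<close>; for Dyck paths it is shown to be empty later.\<close>

lemma obtain_path_of_runs:
  obtains xs n where "w = path_of_runs xs @ replicate n N"
proof -
  have "\<exists>xs n. w = path_of_runs xs @ replicate n N"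
  proof (induction w rule: rev_induct)
    case Nil
    have "[] = path_of_runs [] @ replicate 0 N" by simp
    then show ?case by blast
  next
    case (snoc s w)
    then obtain xs n where w: "w = path_of_runs xs @ replicate n N" by blast
    show ?case
    proof (cases s)
      case N
      then have "w @ [s] = path_of_runs xs @ replicate (Suc n) N"
        by (simp add: w replicate_append_same)
      then show ?thesis by blast
    next
      case E
      then have "w @ [s] = path_of_runs (xs @ [n]) @ replicate 0 N"
        by (simp add: w)
      then show ?thesis by blast
    qed
  qed
  then show thesis using that by blast
qed

text \<open>A prefix that stops inside a run consists of complete runs and some further north steps.
  This reduces a condition on all prefixes to the ends of runs.\<close>

lemma take_path_of_runs:
  "\<exists>j n. j \<le> length xs \<and> take k (path_of_runs xs) = path_of_runs (take j xs) @ replicate n N"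
proof (induction xs arbitrary: k)
  case Nil
  then show ?case by (auto intro: exI[of _ 0])
next
  case (Cons x xs)
  show ?case
  proof (cases "k \<le> x")
    case True
    then have "take k (path_of_runs (x # xs)) = path_of_runs (take 0 (x # xs)) @ replicate k N"
      by simp
    then show ?thesis by blast
  next
    case False
    then obtain k' where k: "k = Suc (x + k')"
      by (metis add_Suc_right less_imp_Suc_add not_le)
    from Cons obtain j n where "j \<le> length xs"
      "take k' (path_of_runs xs) = path_of_runs (take j xs) @ replicate n N" by blast
    then have "Suc j \<le> length (x # xs)"
      "take k (path_of_runs (x # xs)) = path_of_runs (take (Suc j) (x # xs)) @ replicate n N"
      by (auto simp: k Suc_diff_le)
    then show ?thesis by blast
  qed
qed

section \<open>Counting vertical runs\<close>

lemma take_Suc_run_eq_iff: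
  "take (Suc i) (replicate x N @ E # w) = replicate i N @ [E] \<longleftrightarrow> i = x"
proof (induction i arbitrary: x)
  case 0
  show ?case by (cases x) auto
next
  case (Suc i)
  show ?case
  proof (cases x)
    case (Suc y)
    then show ?thesis using Suc.IH[of y] by simp
  qed simp
qed

text \<open>The positions from 1 to \<open>x\<close> are preceded by \<open>N\<close>, so no run
  starts there. The remaining ones are 0, where the first run starts, and the shifted positions of
  \<open>w\<close>.\<close>

lemma vertical_runs_Cons:
  "vertical_runs i (replicate x N @ E # w) =
     (if i = x then {0} else {}) \<union> (\<lambda>p. p + Suc x) ` vertical_runs i w"
  (is "?L = ?R")
proof (rule set_eqI)
  fix p
  consider "p = 0" | "0 < p" "p \<le> x" | q where "p = q + Suc x"
    by (metis add.commute le_add_diff_inverse not_less_eq_eq not_gr_zero)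
  then show "p \<in> ?L \<longleftrightarrow> p \<in> ?R"
  proof cases
    case 1
    have "0 \<in> ?L \<longleftrightarrow> i = x"
      unfolding vertical_runs_def mem_Collect_eq drop_0 take_Suc_run_eq_iff by simp
    then show ?thesis using 1 by auto
  next
    case 2
    then have "(replicate x N @ E # w) ! (p - 1) = N" by (simp add: nth_append)
    then show ?thesis using 2 by (auto simp: vertical_runs_def)
  next
    case 3
    \<comment> \<open>For \<open>q = 0\<close> the preceding letter is the \<open>E\<close> that
      closes the first run; it replaces the condition of standing at the beginning of
      \<open>w\<close>.\<close>
    have "(replicate x N @ E # w) ! (q + x) = (if q = 0 then E else w ! (q - 1))"
      by (auto simp: nth_append nth_Cons')
    then show ?thesis using 3 by (auto simp: vertical_runs_def)
  qed
qed

lemma finite_vertical_runs_path_of_runs: "finite (vertical_runs i (path_of_runs xs))"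
proof (induction xs)
  case Nil
  then show ?case by (simp add: vertical_runs_def)
next
  case (Cons x xs)
  then show ?case by (simp add: vertical_runs_Cons)
qed

lemma card_vertical_runs_path_of_runs:
  "card (vertical_runs i (path_of_runs xs)) = count (mset xs) i"
proof (induction xs)
  case Nil
  then show ?case by (simp add: vertical_runs_def)
next
  case (Cons x xs)
  have "card ((\<lambda>p. p + Suc x) ` vertical_runs i (path_of_runs xs)) = count (mset xs) i"
    by (subst card_image) (auto simp: inj_on_def Cons)
  then show ?case
    using finite_vertical_runs_path_of_runs[of i xs] unfolding path_of_runs_Cons vertical_runs_Cons
    by (auto simp: card_insert_if)
qed

section \<open>The Dyck condition in terms of run lengths\<close>

definition ballot :: "nat \<Rightarrow> nat \<Rightarrow> nat list \<Rightarrow> bool" where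
  "ballot a b xs \<longleftrightarrow> (\<forall>j \<le> length xs. a * j \<le> b * sum_list (take j xs))"

lemma weakly_above_iff:
  assumes "b > 0"
  shows "weakly_above a b w \<longleftrightarrow>
    (\<forall>k \<le> length w. a * count_list (take k w) E \<le> b * count_list (take k w) N)"
proof -
  have "real a / real b * real x \<le> real y \<longleftrightarrow> a * x \<le> b * y" for x y
  proof -
    have "real a / real b * real x \<le> real y \<longleftrightarrow> real (a * x) \<le> real (b * y)"
      using assms by (simp add: field_simps)
    then show ?thesis by (simp only: of_nat_le_iff)
  qed
  then show ?thesis by (simp add: weakly_above_def path_point_def)
qed

text \<open>Only an east step can bring the path closer to the line, so it suffices to test the
  origin and the points right after east steps.\<close>

lemma weakly_above_path_of_runs:
  assumes "b > 0"
  shows "weakly_above a b (path_of_runs xs) \<longleftrightarrow> ballot a b xs"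
proof
  assume above: "weakly_above a b (path_of_runs xs)"
  show "ballot a b xs"
    unfolding ballot_def
  proof (intro allI impI)
    fix j assume j: "j \<le> length xs"
    let ?u = "path_of_runs (take j xs)"
    have split: "path_of_runs xs = ?u @ path_of_runs (drop j xs)"
      by (metis append_take_drop_id path_of_runs_append)
    then have "take (length ?u) (path_of_runs xs) = ?u" "length ?u \<le> length (path_of_runs xs)"
      by simp_all
    then have "a * count_list ?u E \<le> b * count_list ?u N"
      using above unfolding weakly_above_iff[OF assms] by metis
    then show "a * j \<le> b * sum_list (take j xs)" using j by simp
  qed
next
  assume ballot: "ballot a b xs"
  show "weakly_above a b (path_of_runs xs)"
    unfolding weakly_above_iff[OF assms]
  proof (intro allI impI)
    fix k
    obtain j n where j: "j \<le> length xs"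
      and eq: "take k (path_of_runs xs) = path_of_runs (take j xs) @ replicate n N"
      using take_path_of_runs by blast
    \<comment> \<open>The \<open>n\<close> extra north steps of the prefix only enlarge the
      right-hand side of the goal.\<close>
    have "a * j \<le> b * sum_list (take j xs)" using ballot j by (simp add: ballot_def)
    then show "a * count_list (take k (path_of_runs xs)) E
        \<le> b * count_list (take k (path_of_runs xs)) N"
      using j by (simp add: eq count_list_replicate_eq add_mult_distrib2)
  qed
qed

lemma dyck_paths_eq_image:
  assumes "b > 0"
  shows "dyck_paths a b =
    path_of_runs ` {xs. length xs = b \<and> sum_list xs = a \<and> ballot a b xs}"
proof (intro equalityI subsetI)
  fix w assume w: "w \<in> dyck_paths a b"
  obtain xs n where eq: "w = path_of_runs xs @ replicate n N" by (rule obtain_path_of_runs)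
  have len: "length xs = b" and sum: "sum_list xs + n = a" and above: "weakly_above a b w"
    using w by (auto simp: dyck_paths_def lattice_words_def eq count_list_replicate_eq)
  \<comment> \<open>Before the trailing north steps the path has already reached abscissa
    \<open>b\<close>, so its height \<open>a - n\<close> there must be at least
    \<open>a\<close>.\<close>
  have "a * count_list (path_of_runs xs) E \<le> b * count_list (path_of_runs xs) N"
    using above[unfolded weakly_above_iff[OF assms], rule_format, of "length (path_of_runs xs)"]
    by (simp add: eq)
  then have "n = 0" using len sum assms by (simp add: mult.commute)
  then show "w \<in> path_of_runs ` {xs. length xs = b \<and> sum_list xs = a \<and> ballot a b xs}"
    using eq len sum above weakly_above_path_of_runs[OF assms] by auto
next
  fix w assume "w \<in> path_of_runs ` {xs. length xs = b \<and> sum_list xs = a \<and> ballot a b xs}"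
  then show "w \<in> dyck_paths a b"
    using weakly_above_path_of_runs[OF assms] by (auto simp: dyck_paths_def lattice_words_def)
qed

section \<open>The cycle lemma\<close>

lemma ballot_rotate_iff:
  fixes xs :: "nat list"
  defines "b \<equiv> length xs"
  defines "P \<equiv> \<lambda>i. int b * int (sum_list (take i xs)) - int (sum_list xs) * int i"
  assumes k: "k < b"
  shows "ballot (sum_list xs) b (rotate k xs) \<longleftrightarrow> (\<forall>i<b. P k \<le> P i)"
proof -
  \<comment> \<open>Rotating by \<open>k\<close> moves the origin to index \<open>k\<close>: the
    quantities to be tested become the differences \<open>P i - P k\<close>. Since
    \<open>P 0 = P b\<close>, this survives the passage through the end of the list.\<close>
  have ends: "P 0 = P b" by (simp add: P_def b_def)
  have rot: "rotate k xs = drop k xs @ take k xs"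
    using k by (simp add: b_def rotate_drop_take)
  have total: "sum_list (take k xs) + sum_list (drop k xs) = sum_list xs"
    by (metis append_take_drop_id sum_list_append)
  have low: "sum_list xs * j \<le> b * sum_list (take j (rotate k xs)) \<longleftrightarrow> P k \<le> P (k + j)"
    if "j \<le> b - k" for j
  proof -
    have "take j (rotate k xs) = take j (drop k xs)" using that k by (simp add: rot b_def)
    moreover have "sum_list (take (k + j) xs) = sum_list (take k xs) + sum_list (take j (drop k xs))"
      by (simp add: take_add)
    ultimately show ?thesis
      by (simp add: P_def algebra_simps flip: of_nat_mult of_nat_add)
  qed
  \<comment> \<open>Here the prefix wraps around: it consists of the last \<open>b - k\<close>
    entries of \<open>xs\<close> and its first \<open>i\<close> ones. The contributions of one full
    turn, \<open>b * sum_list xs\<close> and \<open>sum_list xs * b\<close>, cancel.\<close>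
  have high: "sum_list xs * (b - k + i) \<le> b * sum_list (take (b - k + i) (rotate k xs)) \<longleftrightarrow> P k \<le> P i"
    if "i \<le> k" for i
  proof -
    have "take (b - k + i) (rotate k xs) = drop k xs @ take i xs"
      using that k by (simp add: rot b_def min_absorb1)
    then have s: "int (sum_list (take (b - k + i) (rotate k xs)))
        = int (sum_list xs) - int (sum_list (take k xs)) + int (sum_list (take i xs))"
      using total by simp
    have idx: "int (b - k + i) = int b - int k + int i" using k by simp
    have "sum_list xs * (b - k + i) \<le> b * sum_list (take (b - k + i) (rotate k xs)) \<longleftrightarrow>
      int (sum_list xs * (b - k + i)) \<le> int (b * sum_list (take (b - k + i) (rotate k xs)))"
      by (rule of_nat_le_iff[symmetric])
    then show ?thesis unfolding of_nat_mult idx s P_def by (simp add: algebra_simps)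
  qed
  show ?thesis
  proof
    assume ballot: "ballot (sum_list xs) b (rotate k xs)"
    show "\<forall>i<b. P k \<le> P i"
    proof (intro allI impI)
      fix i assume "i < b"
      show "P k \<le> P i"
      proof (cases "i \<le> k")
        case True
        then show ?thesis
          using ballot k high[of i] by (simp add: ballot_def b_def)
      next
        case False
        then show ?thesis
          using ballot \<open>i < b\<close> low[of "i - k"] by (simp add: ballot_def b_def)
      qed
    qed
  next
    assume min: "\<forall>i<b. P k \<le> P i"
    \<comment> \<open>The index \<open>b\<close> has to be included, because the unwrapped case
      reaches \<open>k + j = b\<close> at \<open>j = b - k\<close>.\<close>
    then have min: "P k \<le> P i" if "i \<le> b" for i
      using that ends k by (cases "i = b") auto
    show "ballot (sum_list xs) b (rotate k xs)"
      unfolding ballot_def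
    proof (intro allI impI)
      fix j assume j: "j \<le> length (rotate k xs)"
      show "sum_list xs * j \<le> b * sum_list (take j (rotate k xs))"
      proof (cases "j \<le> b - k")
        case True
        then show ?thesis using low[of j] min[of "k + j"] k by simp
      next
        case False
        then show ?thesis
          using high[of "j - (b - k)"] min[of "j - (b - k)"] k j by (simp add: b_def)
      qed
    qed
  qed
qed

lemma cycle_lemma:
  assumes "xs \<noteq> []" and cop: "coprime (sum_list xs) (length xs)"
  shows "\<exists>!k. k < length xs \<and> ballot (sum_list xs) (length xs) (rotate k xs)"
proof -
  let ?b = "length xs"
  let ?P = "\<lambda>i. int ?b * int (sum_list (take i xs)) - int (sum_list xs) * int i"
  have iff: "ballot (sum_list xs) ?b (rotate k xs) \<longleftrightarrow> (\<forall>i<?b. ?P k \<le> ?P i)" if "k < ?b" for k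
    using ballot_rotate_iff that by blast
  \<comment> \<open>Equal values make \<open>length xs\<close> divide
    \<open>sum_list xs * (k - l)\<close>, hence \<open>k - l\<close> by coprimality, and the
    absolute value of \<open>k - l\<close> is below \<open>length xs\<close>. So the minimum is
    attained only once.\<close>
  have inj: "k = l" if kl: "k < ?b" "l < ?b" and eq: "?P k = ?P l" for k l
  proof -
    have "int (sum_list xs) * (int k - int l) =
        int ?b * (int (sum_list (take k xs)) - int (sum_list (take l xs)))"
      using eq by (simp add: algebra_simps)
    then have "int ?b dvd int (sum_list xs) * (int k - int l)" by simp
    then have "int ?b dvd int k - int l"
      using cop by (simp add: coprime_dvd_mult_right_iff coprime_commute)
    then show ?thesis
      using kl dvd_imp_le_int[of "int k - int l" "int ?b"] by fastforce
  qed
  have "{..<?b} \<noteq> {}" using assms(1) by auto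
  then obtain k where k: "k < ?b" "\<forall>i<?b. ?P k \<le> ?P i"
    using ex_is_arg_min_if_finite[of "{..<?b}" ?P]
    by (auto simp: is_arg_min_linorder)
  show ?thesis
  proof (rule ex1I[of _ k])
    show "k < ?b \<and> ballot (sum_list xs) ?b (rotate k xs)"
      using k iff by blast
    fix l assume l: "l < ?b \<and> ballot (sum_list xs) ?b (rotate l xs)"
    then have "?P l \<le> ?P k" using k(1) iff by blast
    moreover have "?P k \<le> ?P l" using k l by blast
    ultimately show "l = k" using inj k(1) l by (meson order_antisym)
  qed
qed

section \<open>Counting the arrangements of a multiset\<close>

lemma mset_rotate: "mset (rotate k xs) = mset xs"
  by (metis add.commute append_take_drop_id mset_append rotate_drop_take)

text \<open>Double counting of the pairs of an arrangement \<open>xs\<close> and a shift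
  \<open>k\<close> for which \<open>rotate k xs\<close> is ballot: each \<open>k\<close> contributes
  as many pairs as there are ballot arrangements, each \<open>xs\<close> exactly one.\<close>

lemma card_ballot_permutations:
  assumes "A \<noteq> {#}" and cop: "coprime (sum_mset A) (size A)"
  shows "size A * card {xs \<in> permutations_of_multiset A. ballot (sum_mset A) (size A) xs}
    = card (permutations_of_multiset A)"
proof -
  let ?S = "permutations_of_multiset A" and ?b = "size A"
  let ?G = "ballot (sum_mset A) (size A)"
  have S: "xs \<in> ?S \<longleftrightarrow> mset xs = A" for xs by (simp add: permutations_of_multiset_def)
  have fin: "finite ?S" by simp
  \<comment> \<open>Rotation by \<open>k\<close> permutes the arrangements; its inverse is rotation
    by \<open>?b - k\<close>, because a full turn is the identity.\<close>
  have rot: "card {xs \<in> ?S. ?G (rotate k xs)} = card {xs \<in> ?S. ?G xs}" if "k < ?b" for k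
  proof (rule bij_betw_same_card[of "rotate k"], rule bij_betw_byWitness[where f' = "rotate (?b - k)"])
    have inv: "rotate ?b xs = xs" if "xs \<in> ?S" for xs
      using that by (auto simp: S intro: rotate_id)
    show "\<forall>xs\<in>{xs \<in> ?S. ?G (rotate k xs)}. rotate (?b - k) (rotate k xs) = xs"
      using inv that by (simp add: rotate_rotate)
    show "\<forall>xs\<in>{xs \<in> ?S. ?G xs}. rotate k (rotate (?b - k) xs) = xs"
      using inv that by (simp add: rotate_rotate)
    show "rotate k ` {xs \<in> ?S. ?G (rotate k xs)} \<subseteq> {xs \<in> ?S. ?G xs}"
      by (auto simp: S mset_rotate)
    show "rotate (?b - k) ` {xs \<in> ?S. ?G xs} \<subseteq> {xs \<in> ?S. ?G (rotate k xs)}"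
      using inv that by (auto simp: S mset_rotate rotate_rotate)
  qed
  have one: "card {k \<in> {..<?b}. ?G (rotate k xs)} = 1" if "xs \<in> ?S" for xs
  proof -
    have xs: "mset xs = A" using that S by simp
    have "xs \<noteq> []" "sum_list xs = sum_mset A" "length xs = ?b"
      using assms(1) xs by (auto simp: sum_mset_sum_list)
    then have "\<exists>!k. k < ?b \<and> ?G (rotate k xs)" using cycle_lemma[of xs] cop by simp
    then obtain k where "{k \<in> {..<?b}. ?G (rotate k xs)} = {k}" by auto
    then show ?thesis by simp
  qed
  have "?b * card {xs \<in> ?S. ?G xs} = (\<Sum>k<?b. card {xs \<in> ?S. ?G (rotate k xs)})"
    using rot by simp
  also have "\<dots> = (\<Sum>xs\<in>?S. card {k \<in> {..<?b}. ?G (rotate k xs)})"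
    by (rule sum_multicount_gen) (auto simp: fin)
  also have "\<dots> = card ?S" using one by simp
  finally show ?thesis .
qed

section \<open>The number of Dyck paths with prescribed runs\<close>

theorem proposition2:
  fixes a b :: nat and m :: "nat \<Rightarrow> nat"
  assumes "a > 0" and "b > 0" and "coprime a b"
    and "(\<Sum>i=0..a. i * m i) = a"
    and "(\<Sum>i=0..a. m i) = b"
  shows "real (card {w \<in> dyck_paths a b. \<forall>i \<le> a. card (vertical_runs i w) = m i})
           = 1 / real b * multinomial b a m
         \<and> 1 / real b * multinomial b a m = fact (b - 1) / (\<Prod>i=0..a. fact (m i))"
proof -
  \<comment> \<open>The prescribed run lengths as a multiset, so that the admissible lists are its
    arrangements.\<close>
  define A where "A = (\<Sum>i=0..a. replicate_mset (m i) i)"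
  have count_A: "count A i = (if i \<le> a then m i else 0)" for i
    by (simp add: A_def count_sum)
  have size_A: "size A = b" by (simp add: A_def size_multiset_sum assms)
  have sum_A: "sum_mset A = a"
  proof -
    have "sum_mset A = (\<Sum>i=0..a. m i * i)" 
      unfolding A_def by (induction a) simp_all
    then show ?thesis using assms(4) by (simp add: mult.commute)
  qed
  \<comment> \<open>The counts are prescribed only up to \<open>a\<close>, but no entry of a list
    with sum \<open>a\<close> exceeds \<open>a\<close>, so they determine the whole
    multiset.\<close>
  have runs_iff: "(\<forall>i\<le>a. count (mset xs) i = m i) \<longleftrightarrow> mset xs = A" if "sum_list xs = a" for xs
  proof
    assume runs: "\<forall>i\<le>a. count (mset xs) i = m i"
    have "count (mset xs) i = 0" if "i > a" for i
      using \<open>sum_list xs = a\<close> that member_le_sum_list[of i xs] by (auto simp: count_eq_zero_iff)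
    then show "mset xs = A" using runs by (intro multiset_eqI) (auto simp: count_A)
  qed (simp add: count_A)
  have "{w \<in> dyck_paths a b. \<forall>i\<le>a. card (vertical_runs i w) = m i} =
      path_of_runs ` {xs \<in> permutations_of_multiset A. ballot a b xs}"
  proof -
    have "length xs = b" "sum_list xs = a" if "mset xs = A" for xs
      using that size_A sum_A by (auto simp: sum_mset_sum_list)
    then have "{xs. (length xs = b \<and> sum_list xs = a \<and> ballot a b xs) \<and> (\<forall>i\<le>a. count (mset xs) i = m i)}
        = {xs \<in> permutations_of_multiset A. ballot a b xs}"
      using runs_iff unfolding permutations_of_multiset_def by blast
    moreover have "{w \<in> path_of_runs ` X. \<forall>i\<le>a. card (vertical_runs i w) = m i} =
        path_of_runs ` {xs. xs \<in> X \<and> (\<forall>i\<le>a. count (mset xs) i = m i)}" for X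
      by (auto simp: card_vertical_runs_path_of_runs)
    ultimately show ?thesis by (simp add: dyck_paths_eq_image[OF assms(2)])
  qed
  then have "card {w \<in> dyck_paths a b. \<forall>i\<le>a. card (vertical_runs i w) = m i} =
      card {xs \<in> permutations_of_multiset A. ballot a b xs}"
    by (simp add: card_image inj_on_subset[OF inj_path_of_runs])
  moreover have "b * card {xs \<in> permutations_of_multiset A. ballot a b xs}
      = card (permutations_of_multiset A)"
    using card_ballot_permutations[of A] assms(2,3) size_A sum_A by fastforce
  then have "real b * real (card {xs \<in> permutations_of_multiset A. ballot a b xs})
      = real (card (permutations_of_multiset A))"
    by (simp only: flip: of_nat_mult)
  moreover have "real (card (permutations_of_multiset A)) = multinomial b a m"
  proof -
    \<comment> \<open>Lengths \<open>i\<close> with \<open>m i = 0\<close> are missing from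
      \<open>set_mset A\<close>, but contribute only the factor \<open>fact 0 = 1\<close>.\<close>
    have "(\<Prod>i\<in>set_mset A. fact (count A i) :: nat) = (\<Prod>i=0..a. fact (m i))"
      by (rule prod.mono_neutral_cong_left) (auto simp: count_A simp flip: count_greater_zero_iff split: if_splits)
    then have "card (permutations_of_multiset A) * (\<Prod>i=0..a. fact (m i)) = fact b"
      using card_permutations_of_multiset_aux[of A] size_A by (simp add: mult.commute)
    then have "real (card (permutations_of_multiset A) * (\<Prod>i=0..a. fact (m i))) = real (fact b)"
      by (rule arg_cong)
    then have "real (card (permutations_of_multiset A)) * (\<Prod>i=0..a. fact (m i)) = fact b"
      by (simp only: of_nat_mult of_nat_prod of_nat_fact)
    then show ?thesis by (simp add: multinomial_def field_simps)
  qed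
  ultimately have "real (card {w \<in> dyck_paths a b. \<forall>i \<le> a. card (vertical_runs i w) = m i})
      = 1 / real b * multinomial b a m"
    using assms(2) by (simp add: nonzero_eq_divide_eq mult.commute)
  moreover have "fact b = real b * fact (b - 1)"
    using assms(2) by (simp add: fact_reduce)
  then have "1 / real b * multinomial b a m = fact (b - 1) / (\<Prod>i=0..a. fact (m i))"
    using assms(2) by (simp add: multinomial_def)
  ultimately show ?thesis by blast
qed

end
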